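(* Let $\mathfrak{B}$ be a Boolean weak contact algebra satisfying (C5) $\forall x\neq\mathsf{0}\,\exists y\neq\mathsf{0}\; y\ll x$. Then $\mathfrak{B}$ is atomless if and only if every G-representative of $\mathfrak{B}$ is a W-representative of $\mathfrak{B}$.
   Context: A Boolean weak contact algebra is a Boolean algebra $\langle B,\cdot,+,-,\mathsf{0},\mathsf{1}\rangle$ with a relation $\mathsf{C}$ satisfying (C0) $\neg(\mathsf{0}\mathrel{\mathsf{C}} x)$; (C1) $x\leq y\wedge x\neq\mathsf{0}\to x\mathrel{\mathsf{C}} y$; (C2) symmetry; (C3) $x\leq y\to\forall z(z\mathrel{\mathsf{C}} x\to z\mathrel{\mathsf{C}} y)$. $x\ll y$ iff $\neg(x\mathrel{\mathsf{C}} -y)$; $x\mathrel{\mathsf{O}} y$ iff $x\cdot y\neq\mathsf{0}$. For $X,Y\subseteq B$, $X\trianglelefteq Y$ means: for every $y\in Y$ there is $x\in X$ with $x\leq y$. A G-representative is a non-empty $Q\subseteq B$ with (r0) $\mathsf{0}\notin Q$; (r1) for all $u,v\in Q$: $u=v$ or $u\ll v$ or $v\ll u$; (r2) for every $u\in Q$ there is $v\in Q$ with $v\ll u$; (r3) for all $x,y$: if $u\mathrel{\mathsf{O}} x$ and $u\mathrel{\mathsf{O}} y$ for all $u\in Q$ then $x\mathrel{\mathsf{C}} y$. An abstractive set is $A\subseteq B$ with (r0), (r1) and (A): there is no non-zero $x\in B$ with $x\leq y$ for all $y\in A$. A W-representative is an abstractive set $A$ such that for every abstractive set $D$, $D\trianglelefteq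 A$ implies $A\trianglelefteq D$. Atomless: every non-zero element has a non-zero element strictly below it. *)

theory Defs
  imports Main
begin

text \<open>
  The Boolean algebra is the type \<open>'a\<close> itself (class \<open>boolean_algebra\<close>), so subsets of the
  algebra are arbitrary sets \<open>'a set\<close>; \<open>inf\<close>, \<open>sup\<close>, unary minus, \<open>bot\<close>, \<open>top\<close> are the
  operations and constants. The class does not exclude the one-element algebra.
\<close>

locale boolean_weak_contact_algebra =
  fixes C :: "'a::boolean_algebra \<Rightarrow> 'a \<Rightarrow> bool"
  assumes C0: "\<not> C bot x"
    and C1: "x \<le> y \<and> x \<noteq> bot \<longrightarrow> C x y"
    and C2: "C x y \<longrightarrow> C y x"
    and C3: "x \<le> y \<longrightarrow> (\<forall>z. C z x \<longrightarrow> C z y)"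

definition well_inside :: "('a::boolean_algebra \<Rightarrow> 'a \<Rightarrow> bool) \<Rightarrow> 'a \<Rightarrow> 'a \<Rightarrow> bool" where
  "well_inside C x y \<longleftrightarrow> \<not> C x (- y)"

definition overlap :: "'a::boolean_algebra \<Rightarrow> 'a \<Rightarrow> bool" where
  "overlap x y \<longleftrightarrow> inf x y \<noteq> bot"

definition covers :: "'a::boolean_algebra set \<Rightarrow> 'a set \<Rightarrow> bool" (infix "\<unlhd>" 50) where
  "X \<unlhd> Y \<longleftrightarrow> (\<forall>y\<in>Y. \<exists>x\<in>X. x \<le> y)"

definition r0 :: "'a::boolean_algebra set \<Rightarrow> bool" where
  "r0 Q \<longleftrightarrow> bot \<notin> Q"

definition r1 :: "('a::boolean_algebra \<Rightarrow> 'a \<Rightarrow> bool) \<Rightarrow> 'a set \<Rightarrow> bool" where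
  "r1 C Q \<longleftrightarrow> (\<forall>u\<in>Q. \<forall>v\<in>Q. u = v \<or> well_inside C u v \<or> well_inside C v u)"

definition r2 :: "('a::boolean_algebra \<Rightarrow> 'a \<Rightarrow> bool) \<Rightarrow> 'a set \<Rightarrow> bool" where
  "r2 C Q \<longleftrightarrow> (\<forall>u\<in>Q. \<exists>v\<in>Q. well_inside C v u)"

definition r3 :: "('a::boolean_algebra \<Rightarrow> 'a \<Rightarrow> bool) \<Rightarrow> 'a set \<Rightarrow> bool" where
  "r3 C Q \<longleftrightarrow> (\<forall>x y. (\<forall>u\<in>Q. overlap u x \<and> overlap u y) \<longrightarrow> C x y)"

definition G_representative :: "('a::boolean_algebra \<Rightarrow> 'a \<Rightarrow> bool) \<Rightarrow> 'a set \<Rightarrow> bool" where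
  "G_representative C Q \<longleftrightarrow> Q \<noteq> {} \<and> r0 Q \<and> r1 C Q \<and> r2 C Q \<and> r3 C Q"

definition abstractive :: "('a::boolean_algebra \<Rightarrow> 'a \<Rightarrow> bool) \<Rightarrow> 'a set \<Rightarrow> bool" where
  "abstractive C A \<longleftrightarrow> r0 A \<and> r1 C A \<and> \<not> (\<exists>x. x \<noteq> bot \<and> (\<forall>y\<in>A. x \<le> y))"

definition W_representative :: "('a::boolean_algebra \<Rightarrow> 'a \<Rightarrow> bool) \<Rightarrow> 'a set \<Rightarrow> bool" where
  "W_representative C A \<longleftrightarrow>
     abstractive C A \<and> (\<forall>D. abstractive C D \<longrightarrow> D \<unlhd> A \<longrightarrow> A \<unlhd> D)"

text \<open>The unused type argument only selects the algebra.\<close>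

definition atomless :: "'a::boolean_algebra itself \<Rightarrow> bool" where
  "atomless (_ :: 'a itself) \<longleftrightarrow> (\<forall>x::'a. x \<noteq> bot \<longrightarrow> (\<exists>y. y \<noteq> bot \<and> y < x))"

definition C5 :: "('a::boolean_algebra \<Rightarrow> 'a \<Rightarrow> bool) \<Rightarrow> bool" where
  "C5 C \<longleftrightarrow> (\<forall>x. x \<noteq> bot \<longrightarrow> (\<exists>y. y \<noteq> bot \<and> well_inside C y x))"

end

theory Submission imports Defs begin

text \<open>
  An atom \<open>a\<close> satisfies \<open>a \<lless> a\<close> by (C5), so \<open>{a}\<close> is a G-representative that is not abstractive.
  Conversely, in an atomless algebra every non-zero element contains two non-zero separated parts,
  so (r3) forbids a non-zero lower bound of a G-representative \<open>Q\<close>. If \<open>D \<unlhd> Q\<close> is abstractive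
  and no element of \<open>Q\<close> lies below some \<open>d \<in> D\<close>, choose \<open>e \<in> D\<close> with \<open>e \<lless> d\<close>: every member of
  \<open>Q\<close> overlaps both \<open>e\<close> and \<open>- d\<close>, so (r3) gives \<open>C e (- d)\<close>, a contradiction.
\<close>

context boolean_weak_contact_algebra
begin

lemma C_mono:
  assumes "C x y" "x \<le> x'" "y \<le> y'"
  shows "C x' y'"
  using assms C2 C3 by blast

lemma overlap_imp_C:
  assumes "overlap x y"
  shows "C x y"
proof -
  have "C (inf x y) (inf x y)"
    using C1 assms by (simp add: overlap_def)
  then show ?thesis
    by (rule C_mono) simp_all
qed

lemma not_le_imp_overlap_compl:
  fixes x y :: 'a
  assumes "\<not> x \<le> y"
  shows "overlap x (- y)"
  using assms by (simp add: overlap_def inf_shunt)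

text \<open>If \<open>x \<le> y\<close> failed, \<open>x\<close> would overlap \<open>- y\<close>,
  and overlapping elements are in contact.\<close>

lemma well_inside_imp_le:
  assumes "well_inside C x y"
  shows "x \<le> y"
  using assms overlap_imp_C not_le_imp_overlap_compl by (auto simp: well_inside_def)

lemma r1_linear:
  assumes "r1 C Q" "u \<in> Q" "v \<in> Q"
  shows "u \<le> v \<or> v \<le> u"
  using assms well_inside_imp_le unfolding r1_def by (metis order_refl)

lemma atom_G_representative:
  assumes "C5 C" "a \<noteq> bot" and atom: "\<And>y. y \<noteq> bot \<Longrightarrow> \<not> y < a"
  shows "G_representative C {a}"
proof -
  obtain y where y: "y \<noteq> bot" "well_inside C y a"
    using assms unfolding C5_def by blast
  then have "y = a"
    using well_inside_imp_le atom by (auto simp: less_le)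
  with y have "r2 C {a}"
    by (simp add: r2_def)
  moreover have "r3 C {a}"
    unfolding r3_def
  proof (intro allI impI)
    fix x y
    assume "\<forall>u\<in>{a}. overlap u x \<and> overlap u y"
    \<comment> \<open>An element overlapping an atom lies above it: its meet with \<open>a\<close>
      is non-zero, so it cannot be strictly below \<open>a\<close>. Contact of \<open>a\<close> with
      itself then passes up to \<open>x\<close> and \<open>y\<close>.\<close>
    then have "\<not> inf a x < a" "\<not> inf a y < a"
      using atom by (simp_all add: overlap_def)
    then have "a \<le> x" "a \<le> y"
      by (metis inf.absorb_iff1 inf_le1 order_le_less)+
    moreover have "C a a"
      using C1 \<open>a \<noteq> bot\<close> by blast
    ultimately show "C x y"
      using C_mono by blast
  qed
  ultimately show ?thesis
    using \<open>a \<noteq> bot\<close> by (simp add: G_representative_def r0_def r1_def)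
qed

text \<open>Take \<open>w\<close> well inside \<open>y\<close> by (C5), and let \<open>z\<close> be
  the remainder \<open>inf x (- y)\<close>, which is non-zero because \<open>y < x\<close>. As
  \<open>w\<close> is not in contact with \<open>- y\<close>, it is not in contact with the smaller
  \<open>z\<close>.\<close>

lemma separated_parts:
  assumes "C5 C" "y \<noteq> bot" "y < x"
  obtains w z where "w \<noteq> bot" "z \<noteq> bot" "w \<le> x" "z \<le> x" "\<not> C w z"
proof -
  obtain w where w: "w \<noteq> bot" "well_inside C w y"
    using assms unfolding C5_def by blast
  have "w \<le> x"
    using well_inside_imp_le[OF w(2)] \<open>y < x\<close> by simp
  moreover have "inf x (- y) \<noteq> bot"
    using not_le_imp_overlap_compl[of x y] \<open>y < x\<close> by (simp add: overlap_def less_le_not_le)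
  moreover have "\<not> C w (inf x (- y))"
    using w(2) C_mono[of w "inf x (- y)" w "- y"] by (auto simp: well_inside_def)
  ultimately show ?thesis
    using that w(1) by (meson inf_le1)
qed

lemma G_representative_abstractive:
  assumes "C5 C" "atomless TYPE('a)" and G: "G_representative C Q"
  shows "abstractive C Q"
proof -
  have False if x: "x \<noteq> bot" "\<forall>q\<in>Q. x \<le> q" for x
  proof -
    obtain y where "y \<noteq> bot" "y < x"
      using assms(2) x(1) by (auto simp: atomless_def)
    with \<open>C5 C\<close> obtain w z
      where wz: "w \<noteq> bot" "z \<noteq> bot" "w \<le> x" "z \<le> x" "\<not> C w z"
      by (rule separated_parts)
    \<comment> \<open>Both parts lie below \<open>x\<close>, hence below every \<open>q\<close>, so
      (r3) would put them in contact.\<close>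
    have "\<forall>q\<in>Q. overlap q w \<and> overlap q z"
    proof
      fix q
      assume "q \<in> Q"
      then have "w \<le> q" "z \<le> q"
        using x(2) wz(3,4) order_trans by blast+
      then show "overlap q w \<and> overlap q z"
        using wz(1,2) by (simp add: overlap_def inf_absorb2)
    qed
    then show False
      using G wz(5) by (auto simp: G_representative_def r3_def)
  qed
  then show ?thesis
    using G by (auto simp: G_representative_def abstractive_def)
qed

text \<open>The non-zero \<open>d\<close> is not a lower bound of \<open>D\<close>, so some
  \<open>e\<close> in \<open>D\<close> is not above \<open>d\<close>. This excludes both
  \<open>e = d\<close> and \<open>d \<lless> e\<close>, and (r1) leaves
  \<open>e \<lless> d\<close>.\<close>

lemma abstractive_well_inside:
  assumes "abstractive C D" "d \<in> D"
  obtains e where "e \<in> D" "well_inside C e d"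
proof -
  have "d \<noteq> bot"
    using assms by (auto simp: abstractive_def r0_def)
  then obtain e where "e \<in> D" "\<not> d \<le> e"
    using assms(1) unfolding abstractive_def by blast
  moreover from this have "well_inside C e d"
    using assms well_inside_imp_le unfolding abstractive_def r1_def by (metis order_refl)
  ultimately show ?thesis
    using that by blast
qed

text \<open>Some \<open>f\<close> in \<open>D\<close> lies below \<open>q\<close>. Since
  \<open>D\<close> is a chain, the smaller of \<open>e\<close> and \<open>f\<close> is a non-zero
  element below both \<open>q\<close> and \<open>e\<close>.\<close>

lemma abstractive_covers_overlap:
  assumes D: "abstractive C D" "D \<unlhd> Q" and "e \<in> D" "q \<in> Q"
  shows "overlap q e"
proof -
  obtain f where f: "f \<in> D" "f \<le> q"
    using D(2) \<open>q \<in> Q\<close> unfolding covers_def by blast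
  have "f \<le> e \<or> e \<le> f"
    using D(1) \<open>e \<in> D\<close> f(1) r1_linear by (auto simp: abstractive_def)
  then have "f \<le> inf q e \<or> e \<le> inf q e"
    using f(2) by auto
  moreover have "f \<noteq> bot" "e \<noteq> bot"
    using D(1) \<open>e \<in> D\<close> f(1) by (auto simp: abstractive_def r0_def)
  ultimately show ?thesis
    unfolding overlap_def by (metis bot_unique)
qed

lemma r3_covers_abstractive:
  assumes "r3 C Q" and D: "abstractive C D" "D \<unlhd> Q"
  shows "Q \<unlhd> D"
  unfolding covers_def
proof (rule ballI, rule ccontr)
  fix d
  assume "d \<in> D" and none: "\<not> (\<exists>q\<in>Q. q \<le> d)"
  obtain e where e: "e \<in> D" "well_inside C e d"
    using abstractive_well_inside D(1) \<open>d \<in> D\<close> .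
  \<comment> \<open>Overlap with \<open>- d\<close> is exactly the failure of
    \<open>q \<le> d\<close>.\<close>
  have "\<forall>q\<in>Q. overlap q e \<and> overlap q (- d)"
    using abstractive_covers_overlap[OF D e(1)] not_le_imp_overlap_compl none by blast
  then have "C e (- d)"
    using \<open>r3 C Q\<close> by (simp add: r3_def)
  then show False
    using e(2) by (simp add: well_inside_def)
qed

end

theorem theorem4p4:
  fixes C :: "'a::boolean_algebra \<Rightarrow> 'a \<Rightarrow> bool"
  assumes "boolean_weak_contact_algebra C"
    and "C5 C"
  shows "atomless TYPE('a) \<longleftrightarrow> (\<forall>Q. G_representative C Q \<longrightarrow> W_representative C Q)"
proof -
  interpret boolean_weak_contact_algebra C
    by fact
  show ?thesis
  proof
    assume "atomless TYPE('a)"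
    then show "\<forall>Q. G_representative C Q \<longrightarrow> W_representative C Q"
      using G_representative_abstractive[OF \<open>C5 C\<close>] r3_covers_abstractive
      by (simp add: W_representative_def G_representative_def)
  next
    assume GW: "\<forall>Q. G_representative C Q \<longrightarrow> W_representative C Q"
    show "atomless TYPE('a)"
    proof (rule ccontr)
      assume "\<not> atomless TYPE('a)"
      then obtain a :: 'a where a: "a \<noteq> bot" "\<And>y. y \<noteq> bot \<Longrightarrow> \<not> y < a"
        by (auto simp: atomless_def)
      then have "abstractive C {a}"
        using GW atom_G_representative[OF \<open>C5 C\<close>] by (auto simp: W_representative_def)
      \<comment> \<open>The atom \<open>a\<close> is itself a non-zero lower bound of
        \<open>{a}\<close>.\<close>
      with a(1) show False
        by (auto simp: abstractive_def)
    qed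
  qed
qed

end
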